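(* Let $n$ and $k$ be integers with $0 \le k \le n-2$, and let $(L_1,\dots,L_k)$ be any $k$-MOLS of order $n$. Then the logarithm of the number of ways to extend $(L_1,\dots,L_k)$ to a $(k+1)$-MOLS of order $n$ (that is, of the number of Latin squares $L_{k+1}$ of order $n$ such that $(L_1,\dots,L_k,L_{k+1})$ is a $(k+1)$-MOLS) is at most $$ n^2 \int_0^1 \log\bigl(1+(n-1)t^{k+2}\bigr)\, dt. $$
   Context: Write $[n]=\{1,\dots,n\}$. A Latin square of order $n$ is an $n\times n$ matrix with entries in $[n]$ such that each $x\in[n]$ appears exactly once in every row and in every column. Two Latin squares $L,L'$ of order $n$ are orthogonal if for all $(x,y)\in[n]^2$ there exist unique $i,j\in[n]$ with $L(i,j)=x$ and $L'(i,j)=y$. A $k$-MOLS of order $n$ is a $k$-tuple $(L_1,\dots,L_k)$ of Latin squares of order $n$ such that $L_i$ and $L_j$ are orthogonal for all $1\le i<j\le k$ (for $k=0$ this is the empty tuple; for $k=1$ it is a single Latin square). All logarithms are natural; if the number of extensions is $0$, the statement is vacuous ($\log 0=-\infty$). *)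

theory Defs
  imports "HOL-Analysis.Analysis" "HOL-Library.FuncSet"
begin

text \<open>
  An \<open>n \<times> n\<close> matrix with entries in \<open>{1..n}\<close> is a function on index pairs that is
  \<^const>\<open>undefined\<close> outside \<open>{1..n} \<times> {1..n}\<close>, so that distinct functions are distinct
  matrices and counting functions counts matrices.
\<close>

definition latin_square :: "nat \<Rightarrow> (nat \<times> nat \<Rightarrow> nat) \<Rightarrow> bool" where
  "latin_square n L \<longleftrightarrow>
     L \<in> {1..n} \<times> {1..n} \<rightarrow>\<^sub>E {1..n} \<and>
     (\<forall>x\<in>{1..n}. \<forall>i\<in>{1..n}. \<exists>!j. j \<in> {1..n} \<and> L (i, j) = x) \<and>
     (\<forall>x\<in>{1..n}. \<forall>j\<in>{1..n}. \<exists>!i. i \<in> {1..n} \<and> L (i, j) = x)"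

text \<open>
  The pair \<open>(i, j)\<close> is required to be unique as a pair, which differs from nesting
  \<open>\<exists>!i. \<exists>!j\<close>.
\<close>

definition orthogonal_squares ::
    "nat \<Rightarrow> (nat \<times> nat \<Rightarrow> nat) \<Rightarrow> (nat \<times> nat \<Rightarrow> nat) \<Rightarrow> bool" where
  "orthogonal_squares n L L' \<longleftrightarrow>
     (\<forall>x\<in>{1..n}. \<forall>y\<in>{1..n}. \<exists>!p. p \<in> {1..n} \<times> {1..n} \<and> L p = x \<and> L' p = y)"

definition is_mols :: "nat \<Rightarrow> nat \<Rightarrow> (nat \<times> nat \<Rightarrow> nat) list \<Rightarrow> bool" where
  "is_mols k n Ls \<longleftrightarrow>
     length Ls = k \<and>
     (\<forall>i<k. latin_square n (Ls ! i)) \<and>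
     (\<forall>i j. i < j \<and> j < k \<longrightarrow> orthogonal_squares n (Ls ! i) (Ls ! j))"

definition mols_extensions ::
    "nat \<Rightarrow> nat \<Rightarrow> (nat \<times> nat \<Rightarrow> nat) list \<Rightarrow> (nat \<times> nat \<Rightarrow> nat) set" where
  "mols_extensions k n Ls = {L. latin_square n L \<and> is_mols (k + 1) n (Ls @ [L])}"

text \<open>Hence \<^const>\<open>card\<close> of this set is a genuine count.\<close>

lemma finite_mols_extensions: "finite (mols_extensions k n Ls)"
proof (rule finite_subset)
  show "mols_extensions k n Ls \<subseteq> {1..n} \<times> {1..n} \<rightarrow>\<^sub>E {1..n}"
    by (auto simp only: mols_extensions_def latin_square_def)
  show "finite ({1..n} \<times> {1..n} \<rightarrow>\<^sub>E {1..n})"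
    by (intro finite_PiE) auto
qed

end

theory Submission
  imports Defs
begin

text \<open>
  Let \<open>X\<close> be uniformly distributed on the set \<open>A\<close> of extensions, let every cell be hidden independently with probability
  \<open>t\<close>, and let \<open>h t\<close> be the mean of \<open>card A\<close> times the conditional entropy of \<open>X\<close> given its
  visible cells. Then \<open>h 0 = 0\<close> and \<open>h 1 = card A * ln (card A)\<close>, and \<open>h' t / card A\<close> is a sum over cells
  \<open>c\<close> of mean conditional entropies of \<open>X c\<close>, each at most the logarithm of the mean number of symbols still
  possible at \<open>c\<close>. Through \<open>c\<close> pass \<open>k + 2\<close> lines (its row, its column, and for every given square
  the cells with the same symbol as \<open>c\<close>), and a symbol other than \<open>X c\<close> occurs in \<open>X\<close> once on each of
  them, in \<open>k + 2\<close> distinct cells. It is still possible only if all of these are hidden, so the mean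
  number of possible symbols is at most \<open>1 + (n - 1) * t ^ (k + 2)\<close>. Integrate over \<open>t\<close>.
\<close>

section \<open>Conditioning a uniform member of a finite family\<close>

text \<open>Given that \<open>X\<close> agrees with \<open>L\<close> on the visible set
  \<open>S\<close>, it is uniform on \<open>agreeing A S L\<close>. Hence the sum over
  \<open>L \<in> A\<close> of the logarithms of these cardinalities is \<open>card A\<close> times
  the conditional entropy of \<open>X\<close> given its values on \<open>S\<close>.\<close>

definition agreeing :: "('p \<Rightarrow> 'v) set \<Rightarrow> 'p set \<Rightarrow> ('p \<Rightarrow> 'v) \<Rightarrow> ('p \<Rightarrow> 'v) set" where
  "agreeing A S L = {L' \<in> A. \<forall>p\<in>S. L' p = L p}"

text \<open>The probability that, among \<open>N\<close> cells, exactly those of \<open>S\<close>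
  are visible.\<close>

definition hiding_weight :: "nat \<Rightarrow> 'p set \<Rightarrow> real \<Rightarrow> real" where
  "hiding_weight N S t = t ^ (N - card S) * (1 - t) ^ card S"

text \<open>Each nonempty fibre of \<open>g\<close> contributes exactly one.\<close>

lemma sum_inverse_fibre_card:
  assumes "finite K"
  shows "(\<Sum>x\<in>K. 1 / real (card {y\<in>K. g y = g x})) = real (card (g ` K))"
proof -
  have "(\<Sum>x\<in>K. 1 / real (card {y\<in>K. g y = g x})) =
      (\<Sum>v\<in>g ` K. \<Sum>x\<in>{x\<in>K. g x = v}. 1 / real (card {y\<in>K. g y = g x}))"
    by (rule sum.image_gen[OF assms])
  also have "\<dots> = (\<Sum>v\<in>g ` K. 1)"
  proof (rule sum.cong[OF refl])
    fix v assume v: "v \<in> g ` K"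
    have "card {x\<in>K. g x = v} > 0"
      using v assms by (auto simp: card_gt_0_iff)
    then show "(\<Sum>x\<in>{x\<in>K. g x = v}. 1 / real (card {y\<in>K. g y = g x})) = 1"
      by (simp add: field_simps)
  qed
  finally show ?thesis by simp
qed

text \<open>Agreement on \<open>S\<close> is an equivalence relation, so the pairs
  \<open>(L, L')\<close> agreeing on \<open>S\<close> can be summed in either order. With
  \<open>L'\<close> fixed, its class splits by the value at \<open>c\<close> into fibres, each of
  total one.\<close>

lemma sum_agreeing_ratio:
  assumes "finite A"
  shows "(\<Sum>L\<in>A. real (card (agreeing A S L)) / real (card (agreeing A (insert c S) L)))
       = (\<Sum>L\<in>A. real (card ((\<lambda>L'. L' c) ` agreeing A S L)))"
proof -
  have "(\<Sum>L\<in>A. real (card (agreeing A S L)) / real (card (agreeing A (insert c S) L)))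
      = (\<Sum>L\<in>A. \<Sum>L'\<in>{L'\<in>A. \<forall>p\<in>S. L' p = L p}. 1 / real (card (agreeing A (insert c S) L)))"
    by (simp add: agreeing_def)
  also have "\<dots> = (\<Sum>L'\<in>A. \<Sum>L\<in>{L\<in>A. \<forall>p\<in>S. L' p = L p}. 1 / real (card (agreeing A (insert c S) L)))"
    by (rule sum.swap_restrict[OF assms assms])
  also have "\<dots> = (\<Sum>L'\<in>A. real (card ((\<lambda>M. M c) ` agreeing A S L')))"
  proof (rule sum.cong[OF refl])
    fix L' assume "L' \<in> A"
    have eq: "{L\<in>A. \<forall>p\<in>S. L' p = L p} = agreeing A S L'"
      by (auto simp: agreeing_def)
    have "(\<Sum>L\<in>agreeing A S L'. 1 / real (card (agreeing A (insert c S) L)))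
        = (\<Sum>L\<in>agreeing A S L'. 1 / real (card {M \<in> agreeing A S L'. M c = L c}))"
      by (intro sum.cong refl arg_cong[where f="\<lambda>s. 1 / real (card s)"]) (auto simp: agreeing_def)
    also have "\<dots> = real (card ((\<lambda>M. M c) ` agreeing A S L'))"
      by (rule sum_inverse_fibre_card) (simp add: agreeing_def assms)
    finally show "(\<Sum>L\<in>{L\<in>A. \<forall>p\<in>S. L' p = L p}. 1 / real (card (agreeing A (insert c S) L)))
        = real (card ((\<lambda>M. M c) ` agreeing A S L'))"
      unfolding eq .
  qed
  finally show ?thesis .
qed

section \<open>The law of the random visible set\<close>

text \<open>Expand \<open>((1 - t) + t) ^ card D\<close>, choosing for every cell whether it is
  visible or hidden.\<close>

lemma sum_hiding_weight:
  assumes "finite D"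
  shows "(\<Sum>S\<in>Pow D. hiding_weight (card D) S t) = 1"
proof -
  have "(\<Prod>x\<in>D. (1 - t) + t) = (\<Sum>S\<in>Pow D. (\<Prod>x\<in>S. 1 - t) * (\<Prod>x\<in>D-S. t))"
    by (rule prod_add[OF assms])
  also have "\<dots> = (\<Sum>S\<in>Pow D. hiding_weight (card D) S t)"
    by (intro sum.cong refl)
      (auto simp: hiding_weight_def card_Diff_subset finite_subset[OF _ assms])
  finally show ?thesis by simp
qed

text \<open>Hiding the cells of \<open>B\<close> costs the factor \<open>t ^ card B\<close>; what
  remains are the weights on \<open>D - B\<close>, which again sum to one.\<close>

lemma sum_hiding_weight_avoiding:
  assumes "finite D" "B \<subseteq> D"
  shows "(\<Sum>S\<in>{S\<in>Pow D. S \<inter> B = {}}. hiding_weight (card D) S t) = t ^ card B"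
proof -
  have eq: "{S\<in>Pow D. S \<inter> B = {}} = Pow (D - B)" using assms by auto
  have "hiding_weight (card D) S t = t ^ card B * hiding_weight (card (D - B)) S t"
    if "S \<in> Pow (D - B)" for S
  proof -
    have fB: "finite B" using assms finite_subset by auto
    have "card (D - B) = card D - card B" "card B \<le> card D"
      using assms fB by (auto simp: card_Diff_subset card_mono)
    moreover have "card S \<le> card (D - B)"
      using that assms by (auto intro: card_mono)
    ultimately have "card D - card S = card B + (card (D - B) - card S)" by simp
    then show ?thesis by (simp add: hiding_weight_def power_add)
  qed
  then have "(\<Sum>S\<in>Pow (D - B). hiding_weight (card D) S t)
      = t ^ card B * (\<Sum>S\<in>Pow (D - B). hiding_weight (card (D - B)) S t)"
    by (simp add: sum_distrib_left)
  then show ?thesis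
    unfolding eq using sum_hiding_weight[of "D - B" t] assms by simp
qed

section \<open>Differentiation in the hiding probability\<close>

lemma sum_Pow_outside:
  assumes "finite C"
  shows "(\<Sum>S\<in>Pow C. \<Sum>c\<in>C-S. g c S) = (\<Sum>c\<in>C. \<Sum>S\<in>Pow (C-{c}). g c S)"
proof -
  have "(\<Sum>S\<in>Pow C. \<Sum>c\<in>{c\<in>C. c \<notin> S}. g c S) = (\<Sum>c\<in>C. \<Sum>S\<in>{S\<in>Pow C. c \<notin> S}. g c S)"
    by (rule sum.swap_restrict) (use assms in auto)
  moreover have "{c\<in>C. c \<notin> S} = C - S" for S by auto
  moreover have "{S\<in>Pow C. c \<notin> S} = Pow (C-{c})" for c by auto
  ultimately show ?thesis by simp
qed

text \<open>A set containing \<open>c\<close> is indexed by what is left when \<open>c\<close> is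
  removed. The sum then runs over the same pairs as the one over cells outside \<open>S\<close>, and
  the two can be subtracted termwise.\<close>

lemma sum_Pow_inside:
  assumes "finite C"
  shows "(\<Sum>S\<in>Pow C. \<Sum>c\<in>S. g c S) = (\<Sum>c\<in>C. \<Sum>S\<in>Pow (C-{c}). g c (insert c S))"
proof -
  have "(\<Sum>S\<in>Pow C. \<Sum>c\<in>S. g c S) = (\<Sum>S\<in>Pow C. \<Sum>c\<in>{c\<in>C. c \<in> S}. g c S)"
    by (intro sum.cong refl) auto
  also have "\<dots> = (\<Sum>c\<in>C. \<Sum>S\<in>{S\<in>Pow C. c \<in> S}. g c S)"
    by (rule sum.swap_restrict) (use assms in auto)
  also have "\<dots> = (\<Sum>c\<in>C. \<Sum>S\<in>Pow (C-{c}). g c (insert c S))"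
  proof (rule sum.cong[OF refl])
    fix c assume c: "c \<in> C"
    show "(\<Sum>S\<in>{S\<in>Pow C. c \<in> S}. g c S) = (\<Sum>S\<in>Pow (C-{c}). g c (insert c S))"
      by (rule sum.reindex_bij_witness[where i="insert c" and j="\<lambda>S. S - {c}"])
        (use c in \<open>auto simp: insert_absorb\<close>)
  qed
  finally show ?thesis .
qed

text \<open>This is Russo's formula, for a function \<open>f\<close> of the visible set in place of a monotone event.\<close>

lemma hiding_mean_has_derivative:
  fixes f :: "'p set \<Rightarrow> real"
  assumes "finite C"
  shows "((\<lambda>t. \<Sum>S\<in>Pow C. hiding_weight (card C) S t * f S) has_real_derivative
      (\<Sum>c\<in>C. \<Sum>S\<in>Pow (C-{c}). hiding_weight (card (C-{c})) S t * (f S - f (insert c S))))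
      (at t within X)"
proof -
  let ?N = "card C"
  \<comment> \<open>The two parts of the derivative of a weight times \<open>f S\<close>, without
    their integer factors. Truncated subtraction in the exponents matters only where that factor is
    zero.\<close>
  let ?P = "\<lambda>S. t ^ (?N - card S - 1) * (1 - t) ^ card S * f S"
  let ?Q = "\<lambda>S. t ^ (?N - card S) * (1 - t) ^ (card S - 1) * f S"
  have "((\<lambda>t. \<Sum>S\<in>Pow C. hiding_weight ?N S t * f S) has_real_derivative
      (\<Sum>S\<in>Pow C. real (?N - card S) * ?P S - real (card S) * ?Q S)) (at t within X)"
    unfolding hiding_weight_def
    by (intro DERIV_sum) (auto intro!: derivative_eq_intros simp: algebra_simps)
  moreover have "(\<Sum>S\<in>Pow C. real (?N - card S) * ?P S - real (card S) * ?Q S)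
      = (\<Sum>S\<in>Pow C. \<Sum>c\<in>C-S. ?P S) - (\<Sum>S\<in>Pow C. \<Sum>c\<in>S. ?Q S)"
    unfolding sum_subtractf[symmetric]
  proof (intro sum.cong refl)
    fix S assume "S \<in> Pow C"
    then have "card (C - S) = ?N - card S"
      using assms finite_subset by (auto intro!: card_Diff_subset)
    then show "real (?N - card S) * ?P S - real (card S) * ?Q S = (\<Sum>c\<in>C-S. ?P S) - (\<Sum>c\<in>S. ?Q S)"
      by simp
  qed
  moreover have "\<dots> = (\<Sum>c\<in>C. \<Sum>S\<in>Pow (C-{c}). ?P S - ?Q (insert c S))"
    unfolding sum_Pow_outside[OF assms] sum_Pow_inside[OF assms] by (simp add: sum_subtractf)
  moreover have "\<dots> = (\<Sum>c\<in>C. \<Sum>S\<in>Pow (C-{c}). hiding_weight (card (C-{c})) S t * (f S - f (insert c S)))"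
  proof (intro sum.cong refl)
    fix c S assume c: "c \<in> C" and S: "S \<in> Pow (C - {c})"
    have "finite S" "c \<notin> S" using S assms finite_subset by auto
    \<comment> \<open>Once the factor \<open>t\<close> or \<open>1 - t\<close> belonging to
      \<open>c\<close> has been differentiated away, both terms carry the weight of \<open>S\<close>
      among the remaining cells.\<close>
    then have "card (insert c S) = Suc (card S)" by simp
    moreover have "card (C - {c}) = ?N - 1" using c assms by simp
    ultimately show "?P S - ?Q (insert c S) = hiding_weight (card (C-{c})) S t * (f S - f (insert c S))"
      by (simp add: hiding_weight_def algebra_simps)
  qed
  ultimately show ?thesis by simp
qed

section \<open>Available symbols and entropy\<close>

text \<open>A symbol \<open>y\<close> other than \<open>L c\<close> survives only if all
  \<open>d\<close> cells blocking it are hidden, which has probability \<open>t ^ d\<close>.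
  Linearity of expectation over the \<open>card V - 1\<close> such symbols gives the bound; the
  leading 1 accounts for \<open>L c\<close> itself.\<close>

lemma mean_available_le:
  assumes D: "finite D" and V: "finite V" and t: "0 \<le> t" "t \<le> 1"
    and maps: "\<And>L'. L' \<in> A \<Longrightarrow> L' c \<in> V" and L: "L \<in> A"
    and block: "\<And>y. y \<in> V \<Longrightarrow> y \<noteq> L c \<Longrightarrow>
      \<exists>B\<subseteq>D. card B = d \<and> (\<forall>L'\<in>A. (\<exists>b\<in>B. L' b = L b) \<longrightarrow> L' c \<noteq> y)"
  shows "(\<Sum>S\<in>Pow D. hiding_weight (card D) S t * real (card ((\<lambda>L'. L' c) ` agreeing A S L)))
      \<le> 1 + (real (card V) - 1) * t ^ d"
proof -
  let ?V = "V - {L c}" and ?w = "\<lambda>S. hiding_weight (card D) S t"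
  obtain B where B: "\<And>y. y \<in> ?V \<Longrightarrow> B y \<subseteq> D"
      "\<And>y. y \<in> ?V \<Longrightarrow> card (B y) = d"
      "\<And>y L' b. y \<in> ?V \<Longrightarrow> L' \<in> A \<Longrightarrow> b \<in> B y \<Longrightarrow> L' b = L b \<Longrightarrow> L' c \<noteq> y"
  proof -
    have "\<forall>y\<in>?V. \<exists>B. B \<subseteq> D \<and> card B = d \<and> (\<forall>L'\<in>A. (\<exists>b\<in>B. L' b = L b) \<longrightarrow> L' c \<noteq> y)"
      using block by auto
    from bchoice[OF this] obtain B where
      "\<forall>y\<in>?V. B y \<subseteq> D \<and> card (B y) = d \<and> (\<forall>L'\<in>A. (\<exists>b\<in>B y. L' b = L b) \<longrightarrow> L' c \<noteq> y)" ..
    then show thesis by (intro that[of B]) blast+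
  qed
  have w0: "?w S \<ge> 0" for S using t by (simp add: hiding_weight_def)
  have avail: "real (card ((\<lambda>L'. L' c) ` agreeing A S L)) \<le> 1 + (\<Sum>y\<in>?V. of_bool (S \<inter> B y = {}))" for S
  proof -
    have "(\<lambda>L'. L' c) ` agreeing A S L \<subseteq> insert (L c) {y\<in>?V. S \<inter> B y = {}}"
      using maps B(3) by (fastforce simp: agreeing_def)
    then have "card ((\<lambda>L'. L' c) ` agreeing A S L) \<le> card (insert (L c) {y\<in>?V. S \<inter> B y = {}})"
      using V by (intro card_mono) auto
    also have "\<dots> \<le> 1 + card {y\<in>?V. S \<inter> B y = {}}"
      using V by (simp add: card_insert_if)
    finally show ?thesis
      using V by (simp add: of_bool_def sum.If_cases Int_def conj_commute flip: of_nat_Suc)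
  qed
  have "(\<Sum>S\<in>Pow D. ?w S * real (card ((\<lambda>L'. L' c) ` agreeing A S L)))
      \<le> (\<Sum>S\<in>Pow D. ?w S * (1 + (\<Sum>y\<in>?V. of_bool (S \<inter> B y = {}))))"
    by (intro sum_mono mult_left_mono avail w0)
  also have "\<dots> = 1 + (\<Sum>y\<in>?V. \<Sum>S\<in>Pow D. ?w S * of_bool (S \<inter> B y = {}))"
    using sum_hiding_weight[OF D, of t]
    by (simp add: distrib_left sum.distrib sum_distrib_left del: sum_mult_of_bool_eq)
      (rule sum.swap)
  also have "(\<Sum>y\<in>?V. \<Sum>S\<in>Pow D. ?w S * of_bool (S \<inter> B y = {})) = (\<Sum>y\<in>?V. t ^ d)"
  proof (rule sum.cong[OF refl])
    fix y assume y: "y \<in> ?V"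
    have "(\<Sum>S\<in>Pow D. ?w S * of_bool (S \<inter> B y = {})) = (\<Sum>S\<in>{S\<in>Pow D. S \<inter> B y = {}}. ?w S)"
      by (rule sum.mono_neutral_cong_right) (use D in auto)
    also have "\<dots> = t ^ d"
      using sum_hiding_weight_avoiding[OF D B(1)[OF y]] B(2)[OF y] by simp
    finally show "(\<Sum>S\<in>Pow D. ?w S * of_bool (S \<inter> B y = {})) = t ^ d" .
  qed
  also have "(\<Sum>y\<in>?V. t ^ d) = (real (card V) - 1) * t ^ d"
  proof -
    have "L c \<in> V" using maps L by auto
    then have "1 \<le> card V" using V by (auto simp: Suc_le_eq card_gt_0_iff)
    then show ?thesis using V \<open>L c \<in> V\<close> by (simp add: of_nat_diff)
  qed
  finally show ?thesis by simp
qed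

text \<open>The left side is \<open>card A\<close> times the mean conditional entropy of
  \<open>X c\<close> given the visible cells among \<open>D\<close>. The tangent of
  \<open>ln\<close> at \<open>a\<close> takes the place of Jensen's inequality: summed over
  \<open>A\<close>, the ratios of class sizes become numbers of available symbols, whose mean is at
  most \<open>a\<close>.\<close>

lemma mean_entropy_increment_le:
  fixes A :: "('p \<Rightarrow> 'v) set"
  assumes A: "finite A" and D: "finite D" and V: "finite V" and V0: "V \<noteq> {}"
    and t: "0 \<le> t" "t \<le> 1"
    and maps: "\<And>L'. L' \<in> A \<Longrightarrow> L' c \<in> V"
    and block: "\<And>L y. L \<in> A \<Longrightarrow> y \<in> V \<Longrightarrow> y \<noteq> L c \<Longrightarrow>
      \<exists>B\<subseteq>D. card B = d \<and> (\<forall>L'\<in>A. (\<exists>b\<in>B. L' b = L b) \<longrightarrow> L' c \<noteq> y)"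
  shows "(\<Sum>S\<in>Pow D. hiding_weight (card D) S t *
        ((\<Sum>L\<in>A. ln (real (card (agreeing A S L)))) - (\<Sum>L\<in>A. ln (real (card (agreeing A (insert c S) L))))))
      \<le> real (card A) * ln (1 + (real (card V) - 1) * t ^ d)"
proof -
  let ?w = "\<lambda>S. hiding_weight (card D) S t"
  let ?m = "\<lambda>S L. real (card (agreeing A S L))"
  define a where "a = 1 + (real (card V) - 1) * t ^ d"
  have "card V \<ge> 1" using V V0 by (simp add: Suc_leI card_gt_0_iff)
  then have a: "a \<ge> 1" using t by (simp add: a_def)
  have w0: "?w S \<ge> 0" for S using t by (simp add: hiding_weight_def)
  have m0: "?m S L > 0" if "L \<in> A" for S L
    using A that by (auto simp: agreeing_def card_gt_0_iff)
  have tangent: "ln (?m S L) - ln (?m (insert c S) L) \<le> ln a - 1 + (?m S L / ?m (insert c S) L) / a"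
    if "L \<in> A" for S L
  proof -
    let ?r = "?m S L / ?m (insert c S) L"
    have r: "?r > 0" using m0[OF that] by simp
    have "ln (?r / a) \<le> ?r / a - 1" using divide_pos_pos[OF r, of a] a by (intro ln_le_minus_one) linarith
    moreover have "ln (?r / a) = ln (?m S L) - ln (?m (insert c S) L) - ln a"
      using r a m0[OF that, of S] m0[OF that, of "insert c S"]
      by (simp add: ln_div ln_mult)
    ultimately show ?thesis by simp
  qed
  have "(\<Sum>S\<in>Pow D. ?w S * ((\<Sum>L\<in>A. ln (?m S L)) - (\<Sum>L\<in>A. ln (?m (insert c S) L))))
      \<le> (\<Sum>S\<in>Pow D. ?w S * (\<Sum>L\<in>A. ln a - 1 + (?m S L / ?m (insert c S) L) / a))"
    unfolding sum_subtractf[symmetric]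
    by (intro sum_mono mult_left_mono w0 tangent)
  also have "\<dots> = (\<Sum>S\<in>Pow D. ?w S * (real (card A) * (ln a - 1)
      + (\<Sum>L\<in>A. real (card ((\<lambda>L'. L' c) ` agreeing A S L))) / a))"
    by (simp add: sum.distrib sum_agreeing_ratio[OF A] del: divide_divide_eq_left flip: sum_divide_distrib)
  also have "\<dots> = (\<Sum>S\<in>Pow D. ?w S) * (real (card A) * (ln a - 1))
      + (\<Sum>S\<in>Pow D. \<Sum>L\<in>A. ?w S * real (card ((\<lambda>L'. L' c) ` agreeing A S L))) / a"
    by (simp add: distrib_left sum.distrib sum_distrib_right sum_distrib_left sum_divide_distrib)
  also have "\<dots> = real (card A) * (ln a - 1)
      + (\<Sum>L\<in>A. \<Sum>S\<in>Pow D. ?w S * real (card ((\<lambda>L'. L' c) ` agreeing A S L))) / a"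
    unfolding sum_hiding_weight[OF D] by (subst sum.swap) simp
  \<comment> \<open>The mean is bounded for each \<open>L\<close> separately. The last term becomes
    \<open>card A\<close>, which cancels the \<open>- 1\<close> of the tangent.\<close>
  also have "\<dots> \<le> real (card A) * (ln a - 1) + (\<Sum>L\<in>A. a) / a"
  proof -
    have "(\<Sum>S\<in>Pow D. ?w S * real (card ((\<lambda>L'. L' c) ` agreeing A S L))) \<le> a" if "L \<in> A" for L
      unfolding a_def by (rule mean_available_le[where A=A, OF D V t]) (fact maps that block[OF that])+
    then show ?thesis using a by (intro add_left_mono divide_right_mono sum_mono) auto
  qed
  also have "\<dots> = real (card A) * ln a" using a by (simp add: algebra_simps)
  finally show ?thesis by (simp add: a_def)
qed

section \<open>The integrated entropy bound\<close>

text \<open>The derivative of \<open>h\<close> is bounded cell by cell and integrated. The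
  combinatorial input is that each wrong symbol at a cell is excluded by any single visible cell
  among \<open>d\<close> others; these may depend on \<open>L\<close>, \<open>c\<close> and
  \<open>y\<close>.\<close>

theorem ln_card_le_integral_blocking:
  fixes A :: "('p \<Rightarrow> 'v) set"
  assumes C: "finite C" and V: "finite V" "V \<noteq> {}" and A: "A \<subseteq> C \<rightarrow>\<^sub>E V" "A \<noteq> {}"
    and block: "\<And>L c y. L \<in> A \<Longrightarrow> c \<in> C \<Longrightarrow> y \<in> V \<Longrightarrow> y \<noteq> L c \<Longrightarrow>
      \<exists>B\<subseteq>C-{c}. card B = d \<and> (\<forall>L'\<in>A. (\<exists>b\<in>B. L' b = L b) \<longrightarrow> L' c \<noteq> y)"
  shows "ln (real (card A))
      \<le> real (card C) * integral {0..1} (\<lambda>t. ln (1 + (real (card V) - 1) * t ^ d))"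
proof -
  have fA: "finite A" using finite_subset[OF A(1)] finite_PiE[OF C, of "\<lambda>_. V"] V by auto
  define f where "f S = (\<Sum>L\<in>A. ln (real (card (agreeing A S L))))" for S
  define h where "h t = (\<Sum>S\<in>Pow C. hiding_weight (card C) S t * f S)" for t
  define h' where "h' t = (\<Sum>c\<in>C. \<Sum>S\<in>Pow (C-{c}).
    hiding_weight (card (C-{c})) S t * (f S - f (insert c S)))" for t
  define u where "u t = ln (1 + (real (card V) - 1) * t ^ d)" for t :: real
  have int_h': "(h' has_integral (h 1 - h 0)) {0..1}"
    unfolding h_def h'_def
    by (rule fundamental_theorem_of_calculus)
      (simp_all only: zero_le_one hiding_mean_has_derivative[OF C]
        flip: has_real_derivative_iff_has_vector_derivative)
  have "card V \<ge> 1" using V by (simp add: Suc_leI card_gt_0_iff)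
  \<comment> \<open>Continuity of \<open>u\<close> on the interval needs the argument of
    \<open>ln\<close> to be nonzero there.\<close>
  then have "1 + (real (card V) - 1) * t ^ d \<ge> 1" if "t \<in> {0..1}" for t
    using that by simp
  then have "u integrable_on {0..1}"
    unfolding u_def by (intro integrable_continuous_real continuous_intros) fastforce
  then have "((\<lambda>t. real (card C) * real (card A) * u t) has_integral
      real (card C) * real (card A) * integral {0..1} u) {0..1}"
    by (intro has_integral_mult_right integrable_integral)
  moreover have "h' t \<le> real (card C) * real (card A) * u t" if t: "t \<in> {0..1}" for t
  proof -
    have "h' t \<le> (\<Sum>c\<in>C. real (card A) * u t)"
      unfolding h'_def f_def u_def
    proof (rule sum_mono, rule mean_entropy_increment_le)
      fix c L assume "c \<in> C" "L \<in> A"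
      then show "L c \<in> V" using A by auto
    qed (use fA C V t block in auto)
    then show ?thesis by simp
  qed
  ultimately have bound: "h 1 - h 0 \<le> real (card C) * real (card A) * integral {0..1} u"
    using has_integral_le[OF int_h'] by blast
  \<comment> \<open>At \<open>t = 0\<close> every cell is visible: since \<open>0 ^ 0 = 1\<close>,
    only \<open>S = C\<close> keeps a nonzero weight.\<close>
  have "h 0 = f C"
  proof -
    have "h 0 = (\<Sum>S\<in>{C}. hiding_weight (card C) S 0 * f S)"
      unfolding h_def
    proof (rule sum.mono_neutral_right)
      show "\<forall>S\<in>Pow C - {C}. hiding_weight (card C) S 0 * f S = 0"
        using card_seteq[OF C] by (auto simp: hiding_weight_def power_0_left)
    qed (use C in auto)
    then show ?thesis by (simp add: hiding_weight_def)
  qed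
  \<comment> \<open>A member of \<open>A\<close> is \<open>undefined\<close> outside
    \<open>C\<close>, so its values on \<open>C\<close> determine it. All classes are singletons and
    contribute \<open>ln 1\<close>.\<close>
  also have "f C = 0"
  proof -
    have "agreeing A C L = {L}" if "L \<in> A" for L
    proof -
      have "L' = L" if "L' \<in> A" "\<forall>p\<in>C. L' p = L p" for L'
        using PiE_ext[of L' C "\<lambda>_. V" L] that \<open>L \<in> A\<close> A by auto
      then show ?thesis using that by (auto simp: agreeing_def)
    qed
    then show ?thesis by (simp add: f_def)
  qed
  finally have h0: "h 0 = 0" .
  \<comment> \<open>At \<open>t = 1\<close> nothing is visible, and the only class is
    \<open>A\<close> itself.\<close>
  have "h 1 = (\<Sum>S\<in>{{}}. hiding_weight (card C) S 1 * f S)"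
    unfolding h_def
  proof (rule sum.mono_neutral_right)
    show "\<forall>S\<in>Pow C - {{}}. hiding_weight (card C) S 1 * f S = 0"
      using finite_subset[OF _ C] by (auto simp: hiding_weight_def power_0_left)
  qed (use C in auto)
  then have h1: "h 1 = real (card A) * ln (real (card A))"
    by (simp add: hiding_weight_def f_def agreeing_def)
  have "card A > 0" using fA A by (simp add: card_gt_0_iff)
  then show ?thesis
    using bound unfolding h0 h1 u_def by (simp add: mult.assoc mult.left_commute)
qed

section \<open>Lines determined by orthogonal Latin squares\<close>

lemma latin_square_row:
  assumes "latin_square n L" "x \<in> {1..n}" "i \<in> {1..n}"
  shows "\<exists>!j. j \<in> {1..n} \<and> L (i, j) = x"
proof -
  have "\<forall>x\<in>{1..n}. \<forall>i\<in>{1..n}. \<exists>!j. j \<in> {1..n} \<and> L (i, j) = x"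
    using assms(1) unfolding latin_square_def by (elim conjE)
  from bspec[OF bspec[OF this assms(2)] assms(3)] show ?thesis .
qed

lemma latin_square_column:
  assumes "latin_square n L" "x \<in> {1..n}" "j \<in> {1..n}"
  shows "\<exists>!i. i \<in> {1..n} \<and> L (i, j) = x"
proof -
  have "\<forall>x\<in>{1..n}. \<forall>j\<in>{1..n}. \<exists>!i. i \<in> {1..n} \<and> L (i, j) = x"
    using assms(1) unfolding latin_square_def by (elim conjE)
  from bspec[OF bspec[OF this assms(2)] assms(3)] show ?thesis .
qed

lemma orthogonal_squares_pair:
  assumes "orthogonal_squares n L L'" "x \<in> {1..n}" "y \<in> {1..n}"
  shows "\<exists>!p. p \<in> {1..n} \<times> {1..n} \<and> L p = x \<and> L' p = y"
  using bspec[OF bspec[OF assms(1)[unfolded orthogonal_squares_def] assms(2)] assms(3)] .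

theorem theorem2:
  fixes n k :: nat and Ls :: "(nat \<times> nat \<Rightarrow> nat) list"
  assumes "k + 2 \<le> n"
    and "is_mols k n Ls"
    and "card (mols_extensions k n Ls) > 0"
  shows "ln (real (card (mols_extensions k n Ls)))
           \<le> (real n)\<^sup>2 * integral {0..1} (\<lambda>t::real. ln (1 + (real n - 1) * t ^ (k + 2)))"
proof -
  let ?A = "mols_extensions k n Ls" and ?C = "{1..n} \<times> {1..n}"
  \<comment> \<open>\<open>F q\<close> labels the lines of family \<open>q\<close>: rows, columns,
    then the symbol classes of the given squares, shifted by 2. The line of this family through
    \<open>c\<close> consists of the cells where \<open>F q\<close> equals
    \<open>F q c\<close>.\<close>
  define F where "F q = (if q = 0 then fst else if q = 1 then snd else Ls ! (q - 2))" for q :: nat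
  have len: "length Ls = k" using assms(2) by (simp add: is_mols_def)
  have latin_F: "latin_square n (F q)" if "2 \<le> q" "q < k + 2" for q
    using assms(2) that by (auto simp: is_mols_def F_def)
  have F_in: "F q p \<in> {1..n}" if "q < k + 2" "p \<in> ?C" for q p
  proof (cases "2 \<le> q")
    case True
    then show ?thesis using latin_F[OF True] that by (auto simp: latin_square_def PiE_iff)
  next
    case False
    then show ?thesis using that by (auto simp: F_def)
  qed
  \<comment> \<open>Lines of different families meet in at most one cell: by orthogonality for two
    squares, by the Latin property for a square and the rows or columns. The order
    \<open>q < q'\<close> matches that in \<open>is_mols\<close>.\<close>
  have F_sep_less: "p = p'"
    if "q < q'" "q' < k + 2" "p \<in> ?C" "p' \<in> ?C" "F q p = F q p'" "F q' p = F q' p'" for q q' p p'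
  proof (cases "2 \<le> q")
    case True
    then have "q - 2 < q' - 2" "q' - 2 < k" using that by linarith+
    then have "orthogonal_squares n (Ls ! (q - 2)) (Ls ! (q' - 2))"
      using assms(2) by (simp add: is_mols_def)
    then have "orthogonal_squares n (F q) (F q')"
      using True that(1) by (simp add: F_def)
    then have "\<exists>!r. r \<in> ?C \<and> F q r = F q p \<and> F q' r = F q' p"
      by (rule orthogonal_squares_pair[OF _ F_in[OF less_trans[OF that(1,2)] that(3)] F_in[OF that(2,3)]])
    moreover have "p \<in> ?C \<and> F q p = F q p \<and> F q' p = F q' p"
      "p' \<in> ?C \<and> F q p' = F q p \<and> F q' p' = F q' p"
      using that(3-6) by simp_all
    ultimately show ?thesis by blast
  next
    case False
    show ?thesis
    proof (cases "2 \<le> q'")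
      case True
      then have lat: "latin_square n (F q')" using latin_F that by auto
      obtain i j i' j' where p: "p = (i, j)" "p' = (i', j')" by fastforce
      have ij: "i \<in> {1..n}" "j \<in> {1..n}" "i' \<in> {1..n}" "j' \<in> {1..n}" using that(3,4) p by auto
      have x: "F q' p \<in> {1..n}" by (rule F_in[OF that(2,3)])
      have eq: "F q' (i', j') = F q' (i, j)" using that(6) p by simp
      consider "q = 0" | "q = 1" using False by linarith
      then show ?thesis
      proof cases
        case 1
        then have i: "i' = i" using that(5) p by (simp add: F_def)
        have "\<exists>!j. j \<in> {1..n} \<and> F q' (i, j) = F q' p"
          by (rule latin_square_row[OF lat x ij(1)])
        then have "j' = j" by (rule ex1E) (metis ij(2,4) eq p(1) i)
        then show ?thesis using i p by simp
      next
        case 2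
        then have j: "j' = j" using that(5) p by (simp add: F_def)
        have "\<exists>!i. i \<in> {1..n} \<and> F q' (i, j) = F q' p"
          by (rule latin_square_column[OF lat x ij(2)])
        then have "i' = i" by (rule ex1E) (metis ij(1,3) eq p(1) j)
        then show ?thesis using j p by simp
      qed
    next
      case False2: False
      with False that show ?thesis by (auto simp: F_def prod_eq_iff)
    qed
  qed
  have F_sep: "p = p'"
    if "q \<noteq> q'" "q < k + 2" "q' < k + 2" "p \<in> ?C" "p' \<in> ?C" "F q p = F q p'" "F q' p = F q' p'" for q q' p p'
    using F_sep_less[of q q' p p'] F_sep_less[of q' q p p'] that by (meson linorder_neqE_nat)
  \<comment> \<open>On each line an extension has every symbol exactly once: on rows and columns
    because it is Latin, on the other lines because it is orthogonal to the given squares.\<close>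
  have line: "\<exists>!p. p \<in> ?C \<and> F q p = x \<and> L p = y"
    if L: "L \<in> ?A" and "q < k + 2" "x \<in> {1..n}" "y \<in> {1..n}" for L q x y
  proof -
    have lat: "latin_square n L" using L by (simp add: mols_extensions_def)
    consider "q = 0" | "q = 1" | "2 \<le> q" by linarith
    then show ?thesis
    proof cases
      case 1
      have "\<exists>!j. j \<in> {1..n} \<and> L (x, j) = y" by (rule latin_square_row[OF lat that(4,3)])
      then obtain j where j: "j \<in> {1..n}" "L (x, j) = y"
        and uniq: "\<And>j'. j' \<in> {1..n} \<Longrightarrow> L (x, j') = y \<Longrightarrow> j' = j" by blast
      show ?thesis
      proof (rule ex1I[of _ "(x, j)"])
        show "(x, j) \<in> ?C \<and> F q (x, j) = x \<and> L (x, j) = y"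
          using 1 j that(3) by (simp add: F_def)
        fix p assume "p \<in> ?C \<and> F q p = x \<and> L p = y"
        then show "p = (x, j)"
          using 1 uniq[of "snd p"] by (cases p) (auto simp: F_def)
      qed
    next
      case 2
      have "\<exists>!i. i \<in> {1..n} \<and> L (i, x) = y" by (rule latin_square_column[OF lat that(4,3)])
      then obtain i where i: "i \<in> {1..n}" "L (i, x) = y"
        and uniq: "\<And>i'. i' \<in> {1..n} \<Longrightarrow> L (i', x) = y \<Longrightarrow> i' = i" by blast
      show ?thesis
      proof (rule ex1I[of _ "(i, x)"])
        show "(i, x) \<in> ?C \<and> F q (i, x) = x \<and> L (i, x) = y"
          using 2 i that(3) by (simp add: F_def)
        fix p assume "p \<in> ?C \<and> F q p = x \<and> L p = y"
        then show "p = (i, x)"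
          using 2 uniq[of "fst p"] by (cases p) (auto simp: F_def)
      qed
    next
      case 3
      have "is_mols (k + 1) n (Ls @ [L])" using L by (simp add: mols_extensions_def)
      moreover have q: "q - 2 < k" using 3 that(2) by linarith
      \<comment> \<open>The new square stands at index \<open>k\<close> of the extended
        list.\<close>
      ultimately have "orthogonal_squares n ((Ls @ [L]) ! (q - 2)) ((Ls @ [L]) ! k)"
        unfolding is_mols_def by auto
      then have "orthogonal_squares n (F q) L"
        using q 3 len by (simp add: F_def nth_append)
      then show ?thesis by (rule orthogonal_squares_pair[OF _ that(3,4)])
    qed
  qed
  have "ln (real (card ?A))
      \<le> real (card ?C) * integral {0..1} (\<lambda>t. ln (1 + (real (card {1..n}) - 1) * t ^ (k + 2)))"
  proof (rule ln_card_le_integral_blocking)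
    show "?A \<subseteq> ?C \<rightarrow>\<^sub>E {1..n}"
      by (auto simp only: mols_extensions_def latin_square_def)
    show "?A \<noteq> {}" using assms(3) by auto
    fix L c y assume L: "L \<in> ?A" and c: "c \<in> ?C" and y: "y \<in> {1..n}" "y \<noteq> L c"
    have "\<forall>q\<in>{..<k+2}. \<exists>p. p \<in> ?C \<and> F q p = F q c \<and> L p = y"
      using line[OF L _ F_in[OF _ c] y(1)] by blast
    \<comment> \<open>\<open>b q\<close> is the cell where \<open>L\<close> has \<open>y\<close> on
      the line of family \<open>q\<close> through \<open>c\<close>. These cells form the blocking
      set.\<close>
    from bchoice[OF this] obtain b where
      "\<forall>q\<in>{..<k+2}. b q \<in> ?C \<and> F q (b q) = F q c \<and> L (b q) = y" ..
    then have b: "b q \<in> ?C" "F q (b q) = F q c" "L (b q) = y" if "q < k + 2" for q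
      using that by auto
    show "\<exists>B\<subseteq>?C-{c}. card B = k + 2 \<and> (\<forall>L'\<in>?A. (\<exists>p\<in>B. L' p = L p) \<longrightarrow> L' c \<noteq> y)"
    proof (intro exI[of _ "b ` {..<k+2}"] conjI ballI impI)
      show "b ` {..<k+2} \<subseteq> ?C - {c}" using b y(2) by blast
      \<comment> \<open>A cell on two of the lines through \<open>c\<close> is \<open>c\<close>
        itself, where \<open>L\<close> does not have \<open>y\<close>.\<close>
      have "inj_on b {..<k+2}"
      proof (rule inj_onI, rule ccontr)
        fix q q' assume q: "q \<in> {..<k+2}" "q' \<in> {..<k+2}" "b q = b q'" "q \<noteq> q'"
        then have "b q = c" using F_sep[of q q' "b q" c] b[of q] b[of q'] c by simp
        then show False using b(3)[of q] q y(2) by simp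
      qed
      then show "card (b ` {..<k+2}) = k + 2" by (simp add: card_image)
      fix L' assume L': "L' \<in> ?A" and "\<exists>p\<in>b ` {..<k+2}. L' p = L p"
      then obtain q where q: "q < k + 2" "L' (b q) = L (b q)" by auto
      \<comment> \<open>Otherwise \<open>L'\<close> would have \<open>y\<close> twice on one line,
        at \<open>c\<close> and at \<open>b q\<close>.\<close>
      show "L' c \<noteq> y"
      proof
        assume "L' c = y"
        moreover have "L' (b q) = y" using q(2) b(3)[OF q(1)] by simp
        ultimately have "b q \<in> ?C \<and> F q (b q) = F q c \<and> L' (b q) = y"
          "c \<in> ?C \<and> F q c = F q c \<and> L' c = y"
          using b(1,2)[OF q(1)] c by simp_all
        then have "b q = c"
          using line[OF L' q(1) F_in[OF q(1) c] y(1)] by (metis (no_types, lifting))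
        then show False using b(3)[OF q(1)] y(2) by simp
      qed
    qed
  qed (use assms(1) in auto)
  then show ?thesis by (simp add: power2_eq_square card_cartesian_product)
qed

end
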